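(* For all integers $v \ge t \ge 4$, \[ g(v,t) < \frac{(2v)^{(t-1)^2}}{t!\,(2v-1)}. \]
   Context: For a positive integer $v$, let $[v]=\{0,\dots,v-1\}$, let $\mathcal{S}_v$ be the group of permutations of $[v]$, and let $\mathcal{S}_{v,t}$ be the set of ordered sequences $(s_1,\dots,s_t)$ of $t$ distinct elements of $[v]$. A permutation $\pi\in\mathcal{S}_v$ covers $s\in\mathcal{S}_{v,t}$ if $\pi^{-1}(s_i)<\pi^{-1}(s_{i+1})$ for all $i\in\{1,\dots,t-1\}$. A PSCA$(v,t,\lambda)$ (perfect sequence covering array) is a multiset $X$ of permutations in $\mathcal{S}_v$ such that every sequence in $\mathcal{S}_{v,t}$ is covered by exactly $\lambda$ permutations of $X$ (counted with multiplicity). For $v\ge t$, $g(v,t)$ denotes the smallest positive integer $\lambda$ such that a PSCA$(v,t,\lambda)$ exists. *)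

theory Defs
  imports Complex_Main "HOL-Library.Multiset" "HOL-Combinatorics.Permutations"
begin

definition sequences :: "nat \<Rightarrow> nat \<Rightarrow> nat list set" where
  "sequences v t = {s. length s = t \<and> distinct s \<and> set s \<subseteq> {0..<v}}"

(* Sequences are lists, hence indexed from 0: the pairs (s_i, s_(i+1)) for i = 1, ..., t-1
   appear as (s ! i, s ! Suc i) with Suc i < t. *)
definition covers :: "(nat \<Rightarrow> nat) \<Rightarrow> nat list \<Rightarrow> bool" where
  "covers p s \<longleftrightarrow> (\<forall>i. Suc i < length s \<longrightarrow> inv p (s ! i) < inv p (s ! Suc i))"

definition is_PSCA :: "nat \<Rightarrow> nat \<Rightarrow> nat \<Rightarrow> (nat \<Rightarrow> nat) multiset \<Rightarrow> bool" where
  "is_PSCA v t l X \<longleftrightarrow>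
     (\<forall>p \<in># X. p permutes {0..<v}) \<and>
     (\<forall>s \<in> sequences v t. size {# p \<in># X. covers p s #} = l)"

definition PSCA_g :: "nat \<Rightarrow> nat \<Rightarrow> nat" where
  "PSCA_g v t = (LEAST l. 0 < l \<and> (\<exists>X. is_PSCA v t l X))"

(* The set minimised over in PSCA_g is nonempty when t \<le> v: take every permutation once. *)

lemma card_covers_le:
  assumes s: "s \<in> sequences v t" and s': "s' \<in> sequences v t"
  shows "card {p. p permutes {0..<v} \<and> covers p s} \<le> card {p. p permutes {0..<v} \<and> covers p s'}"
proof -
  have len: "length s = t" "length s' = t" and dist: "distinct s" "distinct s'"
    and sub: "set s \<subseteq> {0..<v}" "set s' \<subseteq> {0..<v}"
    using s s' by (auto simp: sequences_def)
  define A where "A = {0..<v} - set s"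
  define B where "B = {0..<v} - set s'"
  have "card A = card B"
    using sub len dist by (simp add: A_def B_def card_Diff_subset distinct_card)
  then obtain h where h: "bij_betw h A B"
    using finite_same_card_bij[of A B] by (auto simp: A_def B_def)
  define f where "f x = (if x \<in> set s then s' ! (THE i. i < t \<and> s ! i = x)
                         else if x \<in> {0..<v} then h x else x)" for x
  have f_nth: "f (s ! i) = s' ! i" if "i < t" for i
  proof -
    have "(THE j. j < t \<and> s ! j = s ! i) = i"
      using that dist len by (intro the_equality) (auto simp: nth_eq_iff_index_eq)
    then show ?thesis using that len by (simp add: f_def)
  qed
  have "inj_on f (set s)"
  proof (rule inj_onI)
    fix x y assume "x \<in> set s" "y \<in> set s" "f x = f y"
    then obtain i j where "i < t" "j < t" "x = s ! i" "y = s ! j"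
      using len by (metis in_set_conv_nth)
    with \<open>f x = f y\<close> show "x = y" using dist len by (simp add: f_nth nth_eq_iff_index_eq)
  qed
  moreover have "f ` set s = set s'"
  proof -
    have "set s = (!) s ` {..<t}" "set s' = (!) s' ` {..<t}"
      using len by (auto simp: set_conv_nth)
    then show ?thesis using f_nth by (auto simp: image_image)
  qed
  ultimately have b1: "bij_betw f (set s) (set s')" by (simp add: bij_betw_def)
  have b2: "bij_betw f A B"
    using h by (rule bij_betw_cong[THEN iffD1, rotated]) (auto simp: f_def A_def)
  have "bij_betw f (set s \<union> A) (set s' \<union> B)"
    by (rule bij_betw_combine[OF b1 b2]) (auto simp: B_def)
  moreover have "set s \<union> A = {0..<v}" "set s' \<union> B = {0..<v}"
    using sub by (auto simp: A_def B_def)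
  ultimately have f: "f permutes {0..<v}"
    using sub by (intro bij_imp_permutes) (auto simp: f_def)
  show ?thesis
  proof (rule card_inj_on_le[where f = "\<lambda>p. f \<circ> p"])
    show "inj_on (\<lambda>p. f \<circ> p) {p. p permutes {0..<v} \<and> covers p s}"
      using fun.inj_map[OF permutes_inj[OF f]] by (rule inj_on_subset) simp
    show "finite {p. p permutes {0..<v} \<and> covers p s'}"
      using finite_permutations[of "{0..<v}"] by simp
    show "(\<lambda>p. f \<circ> p) ` {p. p permutes {0..<v} \<and> covers p s}
            \<subseteq> {p. p permutes {0..<v} \<and> covers p s'}"
    proof clarify
      fix p assume p: "p permutes {0..<v}" and c: "covers p s"
      have "inv (f \<circ> p) (s' ! i) = inv p (s ! i)" if "i < t" for i
      proof -
        have "inv f (s' ! i) = s ! i"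
          using f_nth[OF that] permutes_inj[OF f] by (metis inv_f_f)
        then show ?thesis
          using permutes_bij[OF f] permutes_bij[OF p] by (simp add: o_inv_distrib)
      qed
      then have "covers (f \<circ> p) s'" using c len by (simp add: covers_def)
      then show "f \<circ> p permutes {0..<v} \<and> covers (f \<circ> p) s'"
        using permutes_compose[OF p f] by simp
    qed
  qed
qed

lemma PSCA_exists:
  assumes "t \<le> v"
  shows "\<exists>l. 0 < l \<and> (\<exists>X. is_PSCA v t l X)"
proof -
  let ?P = "{p. p permutes {0..<v}}"
  define X where "X = mset_set ?P"
  define l where "l = card {p. p permutes {0..<v} \<and> covers p [0..<t]}"
  have fin: "finite ?P" by (simp add: finite_permutations)
  have s0: "[0..<t] \<in> sequences v t" using assms by (auto simp: sequences_def)
  have "size {# p \<in># X. covers p s #} = l" if "s \<in> sequences v t" for s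
    using card_covers_le[OF that s0] card_covers_le[OF s0 that] fin
    by (simp add: X_def l_def)
  then have "is_PSCA v t l X" using fin by (auto simp: is_PSCA_def X_def)
  moreover have "id \<in> {p. p permutes {0..<v} \<and> covers p [0..<t]}"
    by (auto simp: covers_def permutes_id)
  then have "0 < l" using fin unfolding l_def card_gt_0_iff by fastforce
  ultimately show ?thesis by blast
qed

end

theory Submission
  imports Defs "HOL-Algebra.Algebraic_Closure_Type" "HOL-Library.Z2"
    "HOL-Combinatorics.Multiset_Permutations"
begin

text \<open>
  Put \<open>n = t - 1\<close> and let \<open>q\<close> be the power of 2 with \<open>v \<le> q < 2v\<close>. Place the \<open>v\<close> symbols on the normal
  rational curve \<open>a \<mapsto> (1, a, \<dots>, a\<^bsup>n-1\<^esup>)\<close> in the projective space over \<open>GF(q)\<close>, fix a linear order on the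
  projective points, and let every \<open>g \<in> PGL(n, q)\<close> order the symbols by their images under \<open>g\<close>. Any \<open>t\<close>
  points of the curve form a projective frame, and \<open>PGL(n, q)\<close> is transitive on ordered frames, so the
  number of \<open>g\<close> that put a given sequence in increasing order does not depend on the sequence. It
  equals \<open>\<lambda> = |PGL(n, q)| / t!\<close>, since each \<open>g\<close> sorts exactly one ordering of a given \<open>t\<close>-set. Finally
  \<open>|PGL(n, q)| = |GL(n, q)| / (q - 1) < q\<^bsup>n\<^sup>2\<^esup> / (q - 1)\<close>, and \<open>x\<^bsup>n\<^sup>2\<^esup> / (x - 1)\<close> increases for \<open>x \<ge> 2\<close>.
\<close>

section \<open>Finite fields of characteristic 2\<close>

text \<open>Over an algebraically closed field \<open>p\<close> splits into linear factors. A
  repeated factor would also make the derivative vanish at its root, so the multiset of roots is a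
  set.\<close>

lemma card_roots_alg_closed:
  fixes p :: "'a :: alg_closed_field poly"
  assumes "\<And>x. poly p x = 0 \<Longrightarrow> poly (pderiv p) x \<noteq> 0"
  shows "card {x. poly p x = 0} = degree p"
proof -
  have "p \<noteq> 0" using assms by fastforce
  then obtain A where A: "size A = degree p" "p = smult (lead_coeff p) (\<Prod>x\<in>#A. [:-x, 1:])"
    using alg_closed_imp_factorization by blast
  have root: "poly p x = 0 \<longleftrightarrow> x \<in># A" for x
    using \<open>p \<noteq> 0\<close> by (subst A(2)) (auto simp: poly_prod_mset prod_mset_zero_iff)
  have "count A x = 1" if x: "x \<in># A" for x
  proof (rule ccontr)
    assume "count A x \<noteq> 1"
    then obtain B where "A = B + {#x, x#}"
      using x by (metis add_mset_add_single count_add_mset count_eq_zero_iff multi_member_split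
          union_mset_add_mset_right add.right_neutral One_nat_def)
    then obtain r where "p = [:-x, 1:] * ([:-x, 1:] * r)"
      by (metis (no_types, lifting) A(2) add.right_neutral image_mset_add_mset mult_smult_right
          prod_mset.add_mset union_mset_add_mset_right)
    then have "poly (pderiv p) x = 0" by (simp only: pderiv_mult) simp
    with x assms root show False by blast
  qed
  then have "size A = card (set_mset A)"
    by (simp add: size_multiset_overloaded_eq)
  moreover have "{x. poly p x = 0} = set_mset A" using root by blast
  ultimately show ?thesis using A(1) by simp
qed

text \<open>Squaring is additive because the cross term \<open>2 * x * y\<close> vanishes; induction
  iterates this Frobenius map.\<close>

lemma add_power_2_power_char_2:
  fixes x y :: "'a :: comm_ring_1"
  assumes "(2 :: 'a) = 0"
  shows "(x + y) ^ (2 ^ k) = x ^ (2 ^ k) + y ^ (2 ^ k)"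
proof (induction k)
  case (Suc k)
  have "(x + y) ^ (2 ^ Suc k) = ((x + y) ^ (2 ^ k))\<^sup>2"
    by (simp add: power_mult[symmetric] mult.commute)
  also have "\<dots> = (x ^ (2 ^ k))\<^sup>2 + (y ^ (2 ^ k))\<^sup>2"
    using Suc assms by (simp add: power2_sum)
  finally show ?case by (simp add: power_mult[symmetric] mult.commute)
qed simp

text \<open>The field is a subset of an ambient type because its order depends on \<open>v\<close>,
  which no type can do.\<close>

locale finite_subfield =
  fixes K :: "'k :: field set"
  assumes finite_K: "finite K"
    and zero_K [simp]: "0 \<in> K" and one_K [simp]: "1 \<in> K"
    and add_K [simp]: "\<And>x y. x \<in> K \<Longrightarrow> y \<in> K \<Longrightarrow> x + y \<in> K"
    and uminus_K [simp]: "\<And>x. x \<in> K \<Longrightarrow> - x \<in> K"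
    and mult_K [simp]: "\<And>x y. x \<in> K \<Longrightarrow> y \<in> K \<Longrightarrow> x * y \<in> K"
    and inverse_K [simp]: "\<And>x. x \<in> K \<Longrightarrow> inverse x \<in> K"

text \<open>\<open>K\<close> is the root set of \<open>x ^ (2 ^ k) - x\<close> in the algebraic
  closure of GF(2). The derivative is the constant -1, so all roots are simple; closure under
  addition is additivity of the iterated Frobenius map.\<close>

lemma finite_field_2_power:
  assumes "0 < k"
  shows "\<exists>K :: bit alg_closure set. finite_subfield K \<and> card K = 2 ^ k"
proof -
  let ?q = "2 ^ k :: nat"
  let ?K = "{x :: bit alg_closure. x ^ ?q = x}"
  have two: "(2 :: bit alg_closure) = 0"
    by (metis bit_2_eq_0 to_ac_0 to_ac_numeral)
  have q: "1 < ?q" using assms by (intro one_less_power) auto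
  define p :: "bit alg_closure poly" where "p = monom 1 ?q + [:0, -1:]"
  have "degree p = ?q"
    unfolding p_def using q by (subst degree_add_eq_left) (simp_all add: degree_monom_eq)
  have "of_nat ?q = (0 :: bit alg_closure)"
    using assms two by (simp add: power_0_left)
  then have "poly (pderiv p) x = -1" for x
    by (simp add: p_def pderiv_add pderiv_monom pderiv_pCons poly_monom)
  then have "card {x. poly p x = 0} = ?q"
    using \<open>degree p = ?q\<close> card_roots_alg_closed[of p] by simp
  moreover have "{x. poly p x = 0} = ?K"
    by (auto simp: p_def poly_monom)
  ultimately have card: "card ?K = ?q" by simp
  have neg: "- x = x" for x :: "bit alg_closure"
    using two by (metis add_eq_0_iff mult_2 mult_zero_left)
  have "finite_subfield ?K"
  proof
    \<comment> \<open>An infinite set has \<open>card\<close> 0, whereas this one has a power of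
      2.\<close>
    show "finite ?K" using card by (metis card.infinite power_not_zero zero_neq_numeral)
  qed (use q in \<open>auto simp: add_power_2_power_char_2[OF two] power_mult_distrib power_inverse neg\<close>)
  with card show ?thesis by blast
qed

section \<open>Orderings of the symbols and double counting\<close>

text \<open>Ranking the symbols by their \<open>f\<close>-values gives a permutation
  \<open>r\<close>. The witness is the inverse of \<open>r\<close>, since \<open>covers\<close>
  compares values of the inverse.\<close>

lemma rank_permutation:
  fixes f :: "nat \<Rightarrow> nat"
  assumes inj: "inj_on f {0..<v}"
  shows "\<exists>p. p permutes {0..<v} \<and> (\<forall>a<v. \<forall>b<v. inv_into UNIV p a < inv_into UNIV p b \<longleftrightarrow> f a < f b)"
proof -
  define r where "r a = (if a < v then card {b. b < v \<and> f b < f a} else a)" for a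
  have mono: "r a < r b" if "a < v" "b < v" "f a < f b" for a b
  proof -
    have "{c. c < v \<and> f c < f a} \<subset> {c. c < v \<and> f c < f b}"
      using that by (auto intro: less_trans)
    then have "card {c. c < v \<and> f c < f a} < card {c. c < v \<and> f c < f b}"
      by (intro psubset_card_mono) simp_all
    then show ?thesis using that by (simp add: r_def)
  qed
  have r_iff: "r a < r b \<longleftrightarrow> f a < f b" if "a < v" "b < v" for a b
  proof (cases "f a" "f b" rule: linorder_cases)
    case equal
    then have "a = b" using inj that by (auto dest: inj_onD)
    then show ?thesis by simp
  qed (use mono[of a b] mono[of b a] that in simp_all)
  have "r a < v" if "a < v" for a
  proof -
    have "card {b. b < v \<and> f b < f a} \<le> card ({0..<v} - {a})"
      by (rule card_mono) auto
    then show ?thesis using that by (simp add: r_def)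
  qed
  then have "r ` {0..<v} \<subseteq> {0..<v}" by auto
  moreover have "inj_on r {0..<v}"
  proof (rule inj_onI)
    fix a b assume ab: "a \<in> {0..<v}" "b \<in> {0..<v}" "r a = r b"
    then have "f a = f b" using r_iff[of a b] r_iff[of b a] by auto
    then show "a = b" using inj ab by (auto dest: inj_onD)
  qed
  ultimately have "bij_betw r {0..<v} {0..<v}"
    by (simp add: bij_betw_def endo_inj_surj)
  then have r: "r permutes {0..<v}"
    by (rule bij_imp_permutes) (simp add: r_def)
  then have "inv_into UNIV (inv_into UNIV r) = r" by (simp add: inv_inv_eq permutes_bij)
  with r r_iff show ?thesis by (intro exI[of _ "inv_into UNIV r"]) (auto intro: permutes_inv)
qed

lemma covers_iff_sorted_wrt: "covers p s \<longleftrightarrow> sorted_wrt (<) (map (inv_into UNIV p) s)"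
  unfolding covers_def by (subst sorted_wrt_iff_nth_Suc_transp) auto

text \<open>Each \<open>g\<close> contributes the permutation that lists the symbols by increasing
  \<open>f g\<close>. Different \<open>g\<close> may yield the same permutation, so the image is
  taken as a multiset.\<close>

lemma PSCA_of_arrangements:
  fixes f :: "'i \<Rightarrow> nat \<Rightarrow> nat"
  assumes fin: "finite G" and inj: "\<And>g. g \<in> G \<Longrightarrow> inj_on (f g) {0..<v}"
    and card: "\<And>s. s \<in> sequences v t \<Longrightarrow> card {g \<in> G. sorted_wrt (<) (map (f g) s)} = l"
  shows "\<exists>Y. is_PSCA v t l Y"
proof -
  obtain p where p: "\<And>g. g \<in> G \<Longrightarrow> p g permutes {0..<v}"
    "\<And>g a b. g \<in> G \<Longrightarrow> a < v \<Longrightarrow> b < v \<Longrightarrow> inv_into UNIV (p g) a < inv_into UNIV (p g) b \<longleftrightarrow> f g a < f g b"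
    using rank_permutation[OF inj] by metis
  let ?Y = "image_mset p (mset_set G)"
  have "size {# \<pi> \<in># ?Y. covers \<pi> s #} = l" if s: "s \<in> sequences v t" for s
  proof -
    have "covers (p g) s \<longleftrightarrow> sorted_wrt (<) (map (f g) s)" if "g \<in> G" for g
    proof -
      have "set s \<subseteq> {0..<v}" using s by (simp add: sequences_def)
      then show ?thesis
        unfolding covers_iff_sorted_wrt sorted_wrt_map
        using p(2)[OF that]
        by (intro iffI; elim sorted_wrt_mono_rel[rotated]) (meson atLeastLessThan_iff subsetD)+
    qed
    then have "{g \<in> G. covers (p g) s} = {g \<in> G. sorted_wrt (<) (map (f g) s)}" by blast
    then show ?thesis using card[OF s] fin by (simp add: filter_mset_image_mset)
  qed
  then show ?thesis using p(1) fin by (intro exI[of _ ?Y]) (auto simp: is_PSCA_def)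
qed

text \<open>Sort the values and pull them back along \<open>f\<close>. Uniqueness holds because a
  strictly increasing list is determined by its set of entries.\<close>

lemma ex1_sorted_permutation:
  fixes f :: "'a \<Rightarrow> nat"
  assumes "finite A" and inj: "inj_on f A"
  shows "\<exists>!s. s \<in> permutations_of_set A \<and> sorted_wrt (<) (map f s)"
proof
  let ?l = "sorted_list_of_set (f ` A)"
  let ?s = "map (inv_into A f) ?l"
  have "map f ?s = ?l"
    using assms by (auto simp: f_inv_into_f intro!: map_idI)
  moreover have "set ?s = A" using assms by (auto simp: image_image)
  moreover have "distinct ?s"
    using assms by (auto simp: distinct_map inj_on_inv_into)
  ultimately show "?s \<in> permutations_of_set A \<and> sorted_wrt (<) (map f ?s)"
    by (auto simp: permutations_of_set_def simp del: map_map)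
  fix s assume s: "s \<in> permutations_of_set A \<and> sorted_wrt (<) (map f s)"
  then have "map f s = ?l"
    by (intro strict_sorted_equal) (auto simp: permutations_of_set_def assms(1))
  moreover have "map (inv_into A f) (map f s) = s"
    using s inj by (auto simp: permutations_of_set_def intro!: map_idI)
  ultimately show "s = ?s" by simp
qed

text \<open>Count pairs of some \<open>g\<close> and an ordering \<open>s\<close> of the fixed set
  \<open>{0..<t}\<close> that \<open>g\<close> sorts: each \<open>g\<close> sorts exactly one of the
  orderings, and each of the \<open>fact t\<close> orderings is sorted by \<open>l\<close> elements
  of \<open>G\<close>.\<close>

lemma card_arrangements:
  fixes f :: "'i \<Rightarrow> nat \<Rightarrow> nat"
  assumes fin: "finite G" and inj: "\<And>g. g \<in> G \<Longrightarrow> inj_on (f g) {0..<v}" and "t \<le> v"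
    and card: "\<And>s. s \<in> sequences v t \<Longrightarrow> card {g \<in> G. sorted_wrt (<) (map (f g) s)} = l"
  shows "fact t * l = card G"
proof -
  let ?P = "permutations_of_set {0..<t}"
  have one: "card {s \<in> ?P. sorted_wrt (<) (map (f g) s)} = 1" if "g \<in> G" for g
  proof -
    have "inj_on (f g) {0..<t}"
      using inj[OF that] \<open>t \<le> v\<close> by (auto intro: inj_on_subset)
    then obtain s where "{s \<in> ?P. sorted_wrt (<) (map (f g) s)} = {s}"
      using ex1_sorted_permutation[of "{0..<t}" "f g"] by auto
    then show ?thesis by simp
  qed
  have seq: "s \<in> sequences v t" if "s \<in> ?P" for s
    using that \<open>t \<le> v\<close> by (auto simp: permutations_of_set_def sequences_def dest: distinct_card)
  have "fact t * l = (\<Sum>s\<in>?P. card {g \<in> G. sorted_wrt (<) (map (f g) s)})"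
    using card seq by simp
  also have "\<dots> = 1 * card G"
    using fin one by (intro sum_multicount) auto
  finally show ?thesis by simp
qed

section \<open>Coordinate vectors and the general linear group\<close>

context finite_subfield
begin

text \<open>Padding with zeros makes equality of vectors the same as equality of functions.\<close>

definition vecs :: "nat \<Rightarrow> (nat \<Rightarrow> 'k) set" where
  "vecs n = {x. (\<forall>i<n. x i \<in> K) \<and> (\<forall>i\<ge>n. x i = 0)}"

definition unit_vec :: "nat \<Rightarrow> nat \<Rightarrow> 'k" where
  "unit_vec j = (\<lambda>i. if i = j then 1 else 0)"

text \<open>The fixed value outside \<open>vecs n\<close> gives each linear bijection exactly one
  representative, so that cardinalities are correct.\<close>

definition GL :: "nat \<Rightarrow> ((nat \<Rightarrow> 'k) \<Rightarrow> nat \<Rightarrow> 'k) set" where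
  "GL n = {T. bij_betw T (vecs n) (vecs n) \<and>
     (\<forall>x\<in>vecs n. \<forall>y\<in>vecs n. T (\<lambda>i. x i + y i) = (\<lambda>i. T x i + T y i)) \<and>
     (\<forall>c\<in>K. \<forall>x\<in>vecs n. T (\<lambda>i. c * x i) = (\<lambda>i. c * T x i)) \<and>
     (\<forall>x. x \<notin> vecs n \<longrightarrow> T x = (\<lambda>_. 0))}"

lemma sum_K: "(\<And>j. j \<in> A \<Longrightarrow> f j \<in> K) \<Longrightarrow> sum f A \<in> K"
  by (induction A rule: infinite_finite_induct) auto

lemma vecs_zero [simp]: "(\<lambda>_. 0) \<in> vecs n"
  and vecs_add [simp]: "x \<in> vecs n \<Longrightarrow> y \<in> vecs n \<Longrightarrow> (\<lambda>i. x i + y i) \<in> vecs n"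
  and vecs_scale [simp]: "c \<in> K \<Longrightarrow> x \<in> vecs n \<Longrightarrow> (\<lambda>i. c * x i) \<in> vecs n"
  and vecs_unit_vec [simp]: "j < n \<Longrightarrow> unit_vec j \<in> vecs n"
  by (auto simp: vecs_def unit_vec_def)

lemma vecs_K: "x \<in> vecs n \<Longrightarrow> x i \<in> K"
  by (cases "i < n") (auto simp: vecs_def)

lemma vecs_ge: "x \<in> vecs n \<Longrightarrow> n \<le> i \<Longrightarrow> x i = 0"
  by (auto simp: vecs_def)

lemma vecs_sum:
  assumes "\<And>j. j \<in> A \<Longrightarrow> x j \<in> vecs n"
  shows "(\<lambda>i. \<Sum>j\<in>A. x j i) \<in> vecs n"
proof -
  have "(\<Sum>j\<in>A. x j i) \<in> K" for i
    using vecs_K[OF assms] by (rule sum_K)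
  moreover have "(\<Sum>j\<in>A. x j i) = 0" if "n \<le> i" for i
    using vecs_ge[OF assms that] by (intro sum.neutral) simp
  ultimately show ?thesis by (simp add: vecs_def)
qed

lemma finite_vecs: "finite (vecs n)"
proof -
  let ?F = "{..<n} \<rightarrow>\<^sub>E K"
  have "finite ?F" by (rule finite_PiE) (simp_all add: finite_K)
  moreover have "vecs n \<subseteq> (\<lambda>f i. if i < n then f i else 0) ` ?F"
  proof
    fix x assume "x \<in> vecs n"
    then show "x \<in> (\<lambda>f i. if i < n then f i else 0) ` ?F"
      by (intro image_eqI[of _ _ "restrict x {..<n}"]) (auto simp: vecs_ge vecs_K)
  qed
  ultimately show ?thesis by (rule finite_surj)
qed

lemma vecs_expand:
  assumes "x \<in> vecs n"
  shows "x = (\<lambda>i. \<Sum>j<n. x j * unit_vec j i)"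
proof
  fix i
  show "x i = (\<Sum>j<n. x j * unit_vec j i)"
    using assms by (cases "i < n") (auto simp: unit_vec_def vecs_ge if_distrib cong: if_cong)
qed

lemma
  assumes "T \<in> GL n"
  shows GL_bij: "bij_betw T (vecs n) (vecs n)"
    and GL_add: "\<And>x y. x \<in> vecs n \<Longrightarrow> y \<in> vecs n \<Longrightarrow> T (\<lambda>i. x i + y i) = (\<lambda>i. T x i + T y i)"
    and GL_scale: "\<And>c x. c \<in> K \<Longrightarrow> x \<in> vecs n \<Longrightarrow> T (\<lambda>i. c * x i) = (\<lambda>i. c * T x i)"
    and GL_outside: "\<And>x. x \<notin> vecs n \<Longrightarrow> T x = (\<lambda>_. 0)"
proof -
  note T = assms[unfolded GL_def mem_Collect_eq]
  show "bij_betw T (vecs n) (vecs n)" using T[THEN conjunct1] .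
  show "T (\<lambda>i. x i + y i) = (\<lambda>i. T x i + T y i)" if "x \<in> vecs n" "y \<in> vecs n" for x y
    using T[THEN conjunct2, THEN conjunct1, rule_format, OF that] .
  show "T (\<lambda>i. c * x i) = (\<lambda>i. c * T x i)" if "c \<in> K" "x \<in> vecs n" for c x
    using T[THEN conjunct2, THEN conjunct2, THEN conjunct1, rule_format, OF that] .
  show "T x = (\<lambda>_. 0)" if "x \<notin> vecs n" for x
    using T[THEN conjunct2, THEN conjunct2, THEN conjunct2, rule_format, OF that] .
qed

lemma GL_vecs [simp]: "T \<in> GL n \<Longrightarrow> x \<in> vecs n \<Longrightarrow> T x \<in> vecs n"
  using bij_betw_apply[OF GL_bij] .

lemma GL_zero: "T \<in> GL n \<Longrightarrow> T (\<lambda>_. 0) = (\<lambda>_. 0)"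
  using GL_scale[of T n 0 "\<lambda>_. 0"] by simp

lemma GL_nonzero:
  assumes "T \<in> GL n" "x \<in> vecs n" "x \<noteq> (\<lambda>_. 0)"
  shows "T x \<noteq> (\<lambda>_. 0)"
proof
  assume "T x = (\<lambda>_. 0)"
  then have eq: "T x = T (\<lambda>_. 0)" using GL_zero[OF assms(1)] by simp
  have "x = (\<lambda>_. 0)"
    using inj_onD[OF bij_betw_imp_inj_on[OF GL_bij[OF assms(1)]] eq assms(2) vecs_zero] .
  with assms(3) show False by blast
qed

lemma GL_expand:
  assumes T: "T \<in> GL n" and x: "x \<in> vecs n"
  shows "T x = (\<lambda>i. \<Sum>j<n. x j * T (unit_vec j) i)"
proof -
  have "T (\<lambda>i. \<Sum>j<m. x j * unit_vec j i) = (\<lambda>i. \<Sum>j<m. x j * T (unit_vec j) i)"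
    if "m \<le> n" for m
    using that
  proof (induction m)
    case (Suc m)
    have "(\<lambda>i. \<Sum>j<m. x j * unit_vec j i) \<in> vecs n"
      using Suc.prems vecs_K[OF x] by (intro vecs_sum vecs_scale vecs_unit_vec) auto
    with Suc vecs_K[OF x] show ?case
      by (simp add: GL_add[OF T] GL_scale[OF T])
  qed (simp add: GL_zero[OF T])
  then show ?thesis by (subst vecs_expand[OF x]) simp
qed

text \<open>The matrix \<open>M T\<close> determines \<open>T\<close>, which bounds the number of
  maps by the number of matrices. The bound is strict because the zero matrix \<open>Z\<close> does
  not come from a bijection.\<close>

lemma finite_GL: "finite (GL n)"
  and card_GL_less: "0 < n \<Longrightarrow> card (GL n) < card K ^ n\<^sup>2"
proof -
  define I where "I = {..<n} \<times> {..<n}"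
  define M where "M T = (\<lambda>p\<in>I. T (unit_vec (snd p)) (fst p))" for T :: "(nat \<Rightarrow> 'k) \<Rightarrow> nat \<Rightarrow> 'k"
  define Z :: "nat \<times> nat \<Rightarrow> 'k" where "Z = (\<lambda>p\<in>I. 0)"
  have M_nth: "M T (i, j) = T (unit_vec j) i" if "i < n" "j < n" for T i j
    using that by (simp add: M_def I_def)
  have "T = S" if TS: "T \<in> GL n" "S \<in> GL n" and eq: "M T = M S" for T S
  proof
    fix x
    have "T (unit_vec j) i = S (unit_vec j) i" if "j < n" for i j
    proof (cases "i < n")
      case True
      then show ?thesis using that M_nth[of i j T] M_nth[of i j S] eq by simp
    next
      case False
      then show ?thesis
        using that vecs_ge[OF GL_vecs[OF TS(1) vecs_unit_vec]] vecs_ge[OF GL_vecs[OF TS(2) vecs_unit_vec]]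
        by simp
    qed
    then show "T x = S x"
      using TS by (cases "x \<in> vecs n") (simp_all add: GL_expand[of _ n x] GL_outside)
  qed
  then have inj: "inj_on M (GL n)" by (rule inj_onI)
  have sub: "M ` GL n \<subseteq> I \<rightarrow>\<^sub>E K"
  proof (rule image_subsetI)
    fix T assume "T \<in> GL n"
    then have "T (unit_vec (snd p)) (fst p) \<in> K" if "p \<in> I" for p
      using that by (intro vecs_K[OF GL_vecs[OF _ vecs_unit_vec]]) (auto simp: I_def)
    then show "M T \<in> I \<rightarrow>\<^sub>E K" by (simp add: M_def)
  qed
  have fin: "finite (I \<rightarrow>\<^sub>E K)" by (intro finite_PiE) (simp_all add: finite_K I_def)
  show "finite (GL n)"
    using finite_imageD[OF finite_subset[OF sub fin] inj] .
  assume n: "0 < n"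
  have "M T \<noteq> Z" if T: "T \<in> GL n" for T
  proof
    assume eq: "M T = Z"
    have "T (unit_vec 0) i = 0" for i
    proof (cases "i < n")
      case True
      then show ?thesis using M_nth[of i 0 T] n by (simp add: eq Z_def I_def)
    qed (use vecs_ge[OF GL_vecs[OF T vecs_unit_vec[OF n]]] in simp)
    then have "T (unit_vec 0) = (\<lambda>_. 0)" by auto
    moreover have "unit_vec 0 \<noteq> (\<lambda>_. 0)" by (auto simp: unit_vec_def fun_eq_iff)
    ultimately show False using GL_nonzero[OF T vecs_unit_vec[OF n]] by blast
  qed
  then have "Z \<notin> M ` GL n" by auto
  moreover have "Z \<in> I \<rightarrow>\<^sub>E K" by (simp add: Z_def)
  ultimately have "M ` GL n \<noteq> I \<rightarrow>\<^sub>E K" by metis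
  with sub have "M ` GL n \<subset> I \<rightarrow>\<^sub>E K" by (rule psubsetI)
  then have "card (M ` GL n) < card (I \<rightarrow>\<^sub>E K)" using fin by (rule psubset_card_mono[rotated])
  then show "card (GL n) < card K ^ n\<^sup>2"
    by (simp add: card_image[OF inj] card_funcsetE power2_eq_square I_def)
qed

text \<open>This makes \<open>GL n\<close> nonempty, from which positivity of the covering number
  follows later.\<close>

lemma id_GL: "(\<lambda>x. if x \<in> vecs n then x else (\<lambda>_. 0)) \<in> GL n"
proof -
  have "bij_betw (\<lambda>x. if x \<in> vecs n then x else (\<lambda>_. 0)) (vecs n) (vecs n)"
    by (rule bij_betw_cong[THEN iffD1, OF _ bij_betw_id]) auto
  then show ?thesis by (auto simp: GL_def)
qed

lemma GL_comp:
  assumes T: "T \<in> GL n" and S: "S \<in> GL n"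
  shows "T \<circ> S \<in> GL n"
proof -
  have "bij_betw (T \<circ> S) (vecs n) (vecs n)"
    using bij_betw_trans[OF GL_bij[OF S] GL_bij[OF T]] .
  then show ?thesis
    using GL_vecs[OF S]
    by (simp add: GL_def[of n] GL_add[OF T] GL_add[OF S] GL_scale[OF T] GL_scale[OF S]
        GL_outside[OF S] GL_zero[OF T])
qed

text \<open>Right translation is injective because \<open>S\<close> is onto, and an injective
  self-map of a finite set is surjective; no inverse of \<open>S\<close> has to be built.\<close>

lemma bij_betw_GL_comp:
  assumes S: "S \<in> GL n"
  shows "bij_betw (\<lambda>T. T \<circ> S) (GL n) (GL n)"
proof -
  have "inj_on (\<lambda>T. T \<circ> S) (GL n)"
  proof (rule inj_onI, rule ext)
    fix T U x assume TU: "T \<in> GL n" "U \<in> GL n" "T \<circ> S = U \<circ> S"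
    show "T x = U x"
    proof (cases "x \<in> vecs n")
      case True
      then obtain y where "x = S y"
        using bij_betw_imp_surj_on[OF GL_bij[OF S]] by blast
      then show ?thesis using TU(3) by (metis comp_apply)
    qed (use TU in \<open>simp add: GL_outside\<close>)
  qed
  moreover have "(\<lambda>T. T \<circ> S) ` GL n \<subseteq> GL n" using GL_comp[OF _ S] by blast
  ultimately show ?thesis
    by (simp add: bij_betw_def endo_inj_surj finite_GL)
qed

lemma GL_scaled:
  assumes T: "T \<in> GL n" and c: "c \<in> K" "c \<noteq> 0"
  shows "(\<lambda>x i. c * T x i) \<in> GL n"
proof -
  have "bij_betw (\<lambda>x i. c * x i) (vecs n) (vecs n)"
    using c by (intro bij_betw_byWitness[where f' = "\<lambda>x i. inverse c * x i"])
      (auto simp: mult.assoc[symmetric])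
  from bij_betw_trans[OF GL_bij[OF T] this]
  have "bij_betw (\<lambda>x i. c * T x i) (vecs n) (vecs n)" by (simp add: comp_def)
  then show ?thesis
    using T by (subst GL_def) (auto simp: GL_add GL_scale GL_outside algebra_simps)
qed

section \<open>Reduction modulo scalars\<close>

text \<open>The first nonzero coordinate scales with the vector, so it can normalise a
  representative of a scalar class. At the zero vector the value is 0, whatever index
  \<open>LEAST\<close> returns.\<close>

definition pivot :: "(nat \<Rightarrow> 'k) \<Rightarrow> 'k" where
  "pivot x = x (LEAST i. x i \<noteq> 0)"

lemma pivot_scale: "c \<noteq> 0 \<Longrightarrow> pivot (\<lambda>i. c * x i) = c * pivot x"
  by (simp add: pivot_def)

lemma pivot_nonzero: "x \<noteq> (\<lambda>_. 0) \<Longrightarrow> pivot x \<noteq> 0"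
  unfolding pivot_def using LeastI_ex[of "\<lambda>i. x i \<noteq> 0"] by (auto simp: fun_eq_iff)

lemma pivot_K: "x \<in> vecs n \<Longrightarrow> pivot x \<in> K"
  unfolding pivot_def by (rule vecs_K)

text \<open>The maps with \<open>pivot (T (unit_vec 0)) = 1\<close> represent each class of \<open>GL n\<close> modulo
  scalars exactly once.\<close>

definition PGL :: "nat \<Rightarrow> ((nat \<Rightarrow> 'k) \<Rightarrow> nat \<Rightarrow> 'k) set" where
  "PGL n = {T \<in> GL n. pivot (T (unit_vec 0)) = 1}"

text \<open>Each \<open>T\<close> factors uniquely as a nonzero scalar, the pivot of its column 0,
  times a normalised map. Since \<open>P\<close> ignores scalars, both factors range
  independently.\<close>

lemma card_GL_scale_invariant:
  assumes n: "0 < n"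
    and P: "\<And>T c. T \<in> GL n \<Longrightarrow> c \<in> K \<Longrightarrow> c \<noteq> 0 \<Longrightarrow> P (\<lambda>x i. c * T x i) = P T"
  shows "card {T \<in> GL n. P T} = (card K - 1) * card {T \<in> PGL n. P T}"
proof -
  let ?f = "\<lambda>(c, T) x i. c * T x i"
  let ?p = "\<lambda>T. pivot (T (unit_vec 0))"
  have p: "?p T \<in> K - {0}" if "T \<in> GL n" for T
  proof -
    have "unit_vec 0 \<noteq> (\<lambda>_. 0)" by (auto simp: unit_vec_def fun_eq_iff)
    then show ?thesis
      using that n by (auto simp: pivot_nonzero GL_nonzero intro!: pivot_K[of _ n])
  qed
  have "bij_betw ?f ((K - {0}) \<times> {T \<in> PGL n. P T}) {T \<in> GL n. P T}"
  proof (rule bij_betw_byWitness[where f' = "\<lambda>T. (?p T, \<lambda>x i. inverse (?p T) * T x i)"])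
    show "?f ` ((K - {0}) \<times> {T \<in> PGL n. P T}) \<subseteq> {T \<in> GL n. P T}"
      using P by (auto simp: PGL_def GL_scaled)
    show "(\<lambda>T. (?p T, \<lambda>x i. inverse (?p T) * T x i)) ` {T \<in> GL n. P T}
        \<subseteq> (K - {0}) \<times> {T \<in> PGL n. P T}"
      using P p by (auto simp: PGL_def GL_scaled pivot_scale)
  qed (use p in \<open>auto simp: PGL_def pivot_scale mult.assoc[symmetric]\<close>)
  then show ?thesis
    using finite_K by (simp add: bij_betw_same_card[symmetric] card_cartesian_product)
qed

section \<open>The normal rational curve and projective frames\<close>

definition curve :: "nat \<Rightarrow> 'k \<Rightarrow> nat \<Rightarrow> 'k" where
  "curve n a = (\<lambda>i. if i < n then a ^ i else 0)"

lemma power_K: "a \<in> K \<Longrightarrow> a ^ i \<in> K"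
  by (induction i) auto

lemma vecs_curve [simp]: "a \<in> K \<Longrightarrow> curve n a \<in> vecs n"
  by (auto simp: vecs_def curve_def power_K)

text \<open>A polynomial of degree below \<open>n\<close> acts as a linear functional whose value at
  a curve point is evaluation. Such functionals take the place of Vandermonde determinants.\<close>

lemma poly_eq_sum_curve:
  assumes "degree p < n"
  shows "(\<Sum>i<n. coeff p i * curve n a i) = poly p a"
proof -
  have "(\<Sum>i\<le>degree p. coeff p i * a ^ i) = (\<Sum>i<n. coeff p i * a ^ i)"
    using assms by (intro sum.mono_neutral_left) (auto simp: coeff_eq_0)
  then show ?thesis by (simp add: poly_altdef curve_def)
qed

lemma sum_poly_curve_combination:
  assumes "degree p < n"
  shows "(\<Sum>j\<in>J. c j * poly p (a j)) = (\<Sum>i<n. coeff p i * (\<Sum>j\<in>J. c j * curve n (a j) i))"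
proof -
  have "(\<Sum>j\<in>J. c j * poly p (a j)) = (\<Sum>j\<in>J. \<Sum>i<n. coeff p i * (c j * curve n (a j) i))"
    by (simp add: poly_eq_sum_curve[OF assms, symmetric] sum_distrib_left mult_ac)
  also have "\<dots> = (\<Sum>i<n. coeff p i * (\<Sum>j\<in>J. c j * curve n (a j) i))"
    by (subst sum.swap) (simp add: sum_distrib_left)
  finally show ?thesis .
qed

text \<open>Take the Lagrange product over the nodes below \<open>n\<close> other than
  \<open>j\<close>; it has \<open>n - 1\<close> factors, and its roots avoid both \<open>a j\<close>
  and \<open>a n\<close>.\<close>

lemma ex_separating_poly:
  fixes a :: "nat \<Rightarrow> 'k"
  assumes inj: "inj_on a {..n}" and j: "j < n"
  shows "\<exists>p. degree p < n \<and> (\<forall>k<n. k \<noteq> j \<longrightarrow> poly p (a k) = 0) \<and>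
    poly p (a j) \<noteq> 0 \<and> poly p (a n) \<noteq> 0"
proof -
  let ?p = "\<Prod>k\<in>{..<n} - {j}. [:- a k, 1:]"
  have "degree ?p \<le> sum (degree \<circ> (\<lambda>k. [:- a k, 1:])) ({..<n} - {j})"
    by (rule degree_prod_sum_le) simp
  also have "\<dots> < n" using j by simp
  finally have "degree ?p < n" .
  moreover have "\<forall>k<n. k \<noteq> j \<longrightarrow> poly ?p (a k) = 0"
    by (auto simp: poly_prod)
  moreover have "poly ?p (a j) \<noteq> 0" "poly ?p (a n) \<noteq> 0"
    using j by (auto simp: poly_prod dest: inj_onD[OF inj])
  ultimately show ?thesis by blast
qed

text \<open>The standard projective frame: the \<open>n\<close> unit vectors, followed by the
  all-ones vector at index \<open>n\<close>.\<close>

definition frame :: "nat \<Rightarrow> nat \<Rightarrow> nat \<Rightarrow> 'k" where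
  "frame n j = (if j < n then unit_vec j else (\<lambda>i. if i < n then 1 else 0))"

lemma vecs_frame [simp]: "frame n j \<in> vecs n"
  by (auto simp: frame_def vecs_def unit_vec_def)

text \<open>The first \<open>n\<close> curve points form a basis, in which the last point has only
  nonzero coordinates. Scaling the basis by these coordinates sends the all-ones vector to the last
  point as well.\<close>

lemma GL_frame_to_curve:
  assumes inj: "inj_on a {..n}" and a: "\<And>j. j \<le> n \<Longrightarrow> a j \<in> K"
  shows "\<exists>S\<in>GL n. \<exists>c. \<forall>j\<le>n. c j \<in> K - {0} \<and> S (frame n j) = (\<lambda>i. c j * curve n (a j) i)"
proof -
  define B where "B x = (\<lambda>i. \<Sum>j<n. x j * curve n (a j) i)" for x
  \<comment> \<open>The functional given by \<open>p\<close> kills every basis point except the one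
    at \<open>a j\<close>, so it isolates the coordinate \<open>x j\<close>.\<close>
  have eval: "x j * poly p (a j) = (\<Sum>i<n. coeff p i * B x i)"
    if p: "degree p < n" "\<forall>k<n. k \<noteq> j \<longrightarrow> poly p (a k) = 0" and "j < n" for x p j
  proof -
    have "(\<Sum>k<n. x k * poly p (a k)) = (\<Sum>k\<in>{j}. x k * poly p (a k))"
      using that by (intro sum.mono_neutral_right) auto
    then show ?thesis unfolding B_def using sum_poly_curve_combination[OF p(1), where c = x and a = a and J = "{..<n}"]
      by simp
  qed
  have B_vecs: "B x \<in> vecs n" if "x \<in> vecs n" for x
    unfolding B_def using vecs_K[OF that] a by (intro vecs_sum vecs_scale) auto
  have B_inj: "inj_on B (vecs n)"
  proof (rule inj_onI, rule ext)
    fix x y j assume xy: "x \<in> vecs n" "y \<in> vecs n" "B x = B y"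
    show "x j = y j"
    proof (cases "j < n")
      case True
      from ex_separating_poly[OF inj True] obtain p
        where p: "degree p < n" "\<forall>k<n. k \<noteq> j \<longrightarrow> poly p (a k) = 0" "poly p (a j) \<noteq> 0"
        by blast
      have "x j * poly p (a j) = y j * poly p (a j)"
        using eval[OF p(1,2) True] xy(3) by simp
      with p(3) show ?thesis by simp
    qed (use xy in \<open>simp add: vecs_ge\<close>)
  qed
  have B_bij: "bij_betw B (vecs n) (vecs n)"
    unfolding bij_betw_def using B_inj B_vecs endo_inj_surj[OF finite_vecs _ B_inj] by blast
  \<comment> \<open>The coordinates \<open>c\<close> of the last point are nonzero because the
    separating polynomial does not vanish at \<open>a n\<close>.\<close>
  have "curve n (a n) \<in> B ` vecs n"
    using B_bij a by (simp add: bij_betw_imp_surj_on)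
  then obtain c where c: "c \<in> vecs n" "B c = curve n (a n)" by force
  have c_nonzero: "c j \<noteq> 0" if j: "j < n" for j
  proof -
    from ex_separating_poly[OF inj j] obtain p
      where p: "degree p < n" "\<forall>k<n. k \<noteq> j \<longrightarrow> poly p (a k) = 0" "poly p (a n) \<noteq> 0"
      by blast
    have "c j * poly p (a j) = poly p (a n)"
      using eval[OF p(1,2) j] poly_eq_sum_curve[OF p(1)] c(2) by simp
    with p(3) show ?thesis by auto
  qed
  \<comment> \<open>\<open>S\<close> is \<open>B\<close> after the diagonal map with entries
    \<open>c\<close>, set to zero outside \<open>vecs n\<close> as \<open>GL\<close>
    requires.\<close>
  define S where "S x = (if x \<in> vecs n then B (\<lambda>j. c j * x j) else (\<lambda>_. 0))" for x
  have diag_vecs: "(\<lambda>j. d j * x j) \<in> vecs n" if "d \<in> vecs n" "x \<in> vecs n" for d x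
    using that by (auto simp: vecs_def)
  have inv_c: "(\<lambda>j. inverse (c j)) \<in> vecs n"
    using c(1) by (auto simp: vecs_def)
  have cancel: "c j * (inverse (c j) * x j) = x j" "inverse (c j) * (c j * x j) = x j"
    if "x \<in> vecs n" for x j
    using that c_nonzero[of j] by (cases "j < n"; simp add: vecs_ge mult.assoc[symmetric])+
  have "bij_betw (\<lambda>x j. c j * x j) (vecs n) (vecs n)"
    using c(1) inv_c diag_vecs cancel
    by (intro bij_betw_byWitness[where f' = "\<lambda>x j. inverse (c j) * x j"]) auto
  from bij_betw_trans[OF this B_bij] have "bij_betw S (vecs n) (vecs n)"
    by (rule bij_betw_cong[THEN iffD1, rotated]) (simp add: S_def)
  then have "S \<in> GL n"
    by (auto simp: GL_def S_def B_def algebra_simps sum.distrib sum_distrib_left)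
  moreover have "S (frame n j) = (\<lambda>i. (if j < n then c j else 1) * curve n (a j) i)" if "j \<le> n" for j
  proof (cases "j < n")
    case True
    have "(\<Sum>k<n. c k * unit_vec j k * curve n (a k) i) = c j * curve n (a j) i" for i
      using True by (simp add: unit_vec_def if_distrib[of "\<lambda>x. _ * x"] if_distrib[of "\<lambda>x. x * _"]
          cong: if_cong)
    then show ?thesis
      using True vecs_frame[of n j] by (simp add: S_def B_def frame_def)
  next
    case False
    have "(\<lambda>k. c k * frame n j k) = c"
      using False c(1) by (auto simp: frame_def vecs_ge)
    then show ?thesis
      using False \<open>j \<le> n\<close> c(2) vecs_frame[of n j] by (simp add: S_def)
  qed
  ultimately show ?thesis
    using c_nonzero vecs_K[OF c(1)]
    by (intro bexI[of _ S] exI[of _ "\<lambda>j. if j < n then c j else 1"]) auto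
qed

section \<open>Projective points and the covering array\<close>

text \<open>For nonzero \<open>x\<close> this is the projective point of \<open>x\<close>, encoded
  as the set of its nonzero multiples.\<close>

definition line :: "(nat \<Rightarrow> 'k) \<Rightarrow> (nat \<Rightarrow> 'k) set" where
  "line x = (\<lambda>c i. c * x i) ` (K - {0})"

lemma line_scale:
  assumes "c \<in> K - {0}"
  shows "line (\<lambda>i. c * x i) = line x"
proof -
  \<comment> \<open>Multiplication by \<open>c\<close> permutes the finite set of nonzero
    scalars.\<close>
  have "(\<lambda>d. d * c) ` (K - {0}) = K - {0}"
    using assms by (intro endo_inj_surj) (auto simp: finite_K inj_on_def)
  then have "line x = (\<lambda>d i. d * x i) ` (\<lambda>d. d * c) ` (K - {0})"
    by (simp add: line_def)
  then show ?thesis by (simp add: line_def image_image mult.assoc)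
qed

lemma line_eqD: "line x = line y \<Longrightarrow> \<exists>c\<in>K. x = (\<lambda>i. c * y i)"
proof -
  assume eq: "line x = line y"
  have "x \<in> line x"
    unfolding line_def by (rule image_eqI[of _ _ 1]) auto
  then show ?thesis unfolding eq by (auto simp: line_def)
qed

text \<open>After cancelling \<open>T\<close>, coordinate 0 forces the scalar to be 1, and
  coordinate 1 then gives \<open>a = b\<close>; this is where \<open>2 \<le> n\<close>
  enters.\<close>

lemma curve_line_inj:
  assumes T: "T \<in> GL n" and n: "2 \<le> n" and ab: "a \<in> K" "b \<in> K"
    and eq: "line (T (curve n a)) = line (T (curve n b))"
  shows "a = b"
proof -
  obtain c where c: "c \<in> K" "T (curve n a) = (\<lambda>i. c * T (curve n b) i)"
    using line_eqD[OF eq] by blast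
  then have "T (curve n a) = T (\<lambda>i. c * curve n b i)"
    using T ab by (simp add: GL_scale)
  then have "curve n a = (\<lambda>i. c * curve n b i)"
    using c ab by (elim inj_onD[OF bij_betw_imp_inj_on[OF GL_bij[OF T]]]) auto
  then have "curve n a i = c * curve n b i" for i by metis
  from this[of 0] this[of 1] show ?thesis using n by (simp add: curve_def)
qed

text \<open>Composition with a map from the frame to the curve points of \<open>s\<close> turns maps
  that sort \<open>s\<close> into maps that sort the frame. Composites need not be normalised, so
  this comparison takes place in \<open>GL n\<close>; both counts are then divided by
  \<open>card K - 1\<close>.\<close>

lemma ex_PSCA_PGL:
  assumes n: "2 \<le> n" and nv: "Suc n \<le> v" and v: "v \<le> card K"
  shows "\<exists>l Y. 0 < l \<and> is_PSCA v (Suc n) l Y \<and> fact (Suc n) * l * (card K - 1) < card K ^ n\<^sup>2"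
proof -
  obtain b where b: "inj_on b {0..<v}" "b ` {0..<v} \<subseteq> K"
    using card_le_inj[of "{0..<v}" K] finite_K v by auto
  have "finite (line ` vecs n)" using finite_vecs by blast
  \<comment> \<open>Any injection into the naturals serves as the linear order on projective
    points.\<close>
  then obtain h :: "(nat \<Rightarrow> 'k) set \<Rightarrow> nat" where h: "inj_on h (line ` vecs n)"
    using finite_imp_inj_to_nat_seg by metis
  define f where "f T a = h (line (T (curve n (b a))))" for T a
  \<comment> \<open>Counting maps that sort the frame gives a number defined without reference to a
    sequence.\<close>
  define l where "l = card {T \<in> PGL n. sorted_wrt (<) (map (\<lambda>j. h (line (T (frame n j)))) [0..<Suc n])}"
  have q: "0 < card K - 1" using n nv v by simp
  have PGL_GL: "T \<in> GL n" if "T \<in> PGL n" for T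
    using that by (simp add: PGL_def)
  have fin: "finite (PGL n)"
    using finite_GL by (rule finite_subset[rotated]) (auto simp: PGL_def)
  have inj: "inj_on (f T) {0..<v}" if "T \<in> PGL n" for T
  proof (rule inj_onI)
    fix x y assume xy: "x \<in> {0..<v}" "y \<in> {0..<v}" "f T x = f T y"
    have K: "b x \<in> K" "b y \<in> K" using b(2) xy by auto
    have "line (T (curve n (b x))) = line (T (curve n (b y)))"
      using xy(3) K PGL_GL[OF that] unfolding f_def by (elim inj_onD[OF h]) auto
    then have "b x = b y" by (rule curve_line_inj[OF PGL_GL[OF that] n K])
    then show "x = y" using inj_onD[OF b(1)] xy by blast
  qed
  have card_l: "card {T \<in> PGL n. sorted_wrt (<) (map (f T) s)} = l"
    if s: "s \<in> sequences v (Suc n)" for s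
  proof -
    have s': "length s = Suc n" "distinct s" "set s \<subseteq> {0..<v}"
      using s by (auto simp: sequences_def)
    have s_K: "b (s ! j) \<in> K" if "j \<le> n" for j
    proof -
      have "s ! j \<in> {0..<v}" using that s' nth_mem[of j s] by (auto simp del: nth_mem)
      then show ?thesis using b(2) by blast
    qed
    have "inj_on (\<lambda>j. b (s ! j)) {..n}"
    proof (rule inj_onI)
      fix j k assume jk: "j \<in> {..n}" "k \<in> {..n}" "b (s ! j) = b (s ! k)"
      then have "j < length s" "k < length s" using s'(1) by auto
      moreover from this have "s ! j = s ! k"
        using s'(3) nth_mem by (intro inj_onD[OF b(1) jk(3)]) blast+
      ultimately show "j = k" using s'(2) by (simp add: nth_eq_iff_index_eq)
    qed
    from GL_frame_to_curve[OF this s_K] obtain S c where S: "S \<in> GL n"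
      and c: "\<And>j. j \<le> n \<Longrightarrow> c j \<in> K - {0}"
        "\<And>j. j \<le> n \<Longrightarrow> S (frame n j) = (\<lambda>i. c j * curve n (b (s ! j)) i)"
      by blast
    let ?P = "\<lambda>T. sorted_wrt (<) (map (\<lambda>j. h (line (T (frame n j)))) [0..<Suc n])"
    let ?Q = "\<lambda>T. sorted_wrt (<) (map (f T) s)"
    have PQ: "?P (T \<circ> S) \<longleftrightarrow> ?Q T" if T: "T \<in> GL n" for T
    proof -
      have "map (\<lambda>j. h (line ((T \<circ> S) (frame n j)))) [0..<Suc n] = map (f T) s"
      proof (rule nth_equalityI)
        fix j assume "j < length (map (\<lambda>j. h (line ((T \<circ> S) (frame n j)))) [0..<Suc n])"
        then have j: "j \<le> n" "j < Suc n" by auto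
        \<comment> \<open>\<open>T\<close> carries the scalar \<open>c j\<close> along, and
          \<open>line\<close> absorbs it.\<close>
        have "line (T (S (frame n j))) = line (T (curve n (b (s ! j))))"
          using c[OF j(1)] s_K[OF j(1)] by (simp add: GL_scale[OF T] line_scale)
        then show "map (\<lambda>j. h (line ((T \<circ> S) (frame n j)))) [0..<Suc n] ! j = map (f T) s ! j"
          using j s'(1) by (simp add: f_def del: upt_Suc)
      qed (simp add: s'(1))
      then show ?thesis by simp
    qed
    have "bij_betw (\<lambda>T. T \<circ> S) {T \<in> GL n. ?Q T} {T \<in> GL n. ?P T}"
      by (rule bij_betw_Collect[OF bij_betw_GL_comp[OF S]]) (rule PQ)
    then have "card {T \<in> GL n. ?Q T} = card {T \<in> GL n. ?P T}"
      by (rule bij_betw_same_card)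
    moreover have "card {T \<in> GL n. ?Q T} = (card K - 1) * card {T \<in> PGL n. ?Q T}"
      using n by (intro card_GL_scale_invariant) (auto simp: f_def[abs_def] line_scale)
    moreover have "card {T \<in> GL n. ?P T} = (card K - 1) * l"
      unfolding l_def using n by (intro card_GL_scale_invariant) (auto simp: line_scale)
    ultimately show ?thesis using q by simp
  qed
  have "card (GL n) = (card K - 1) * card (PGL n)"
    using card_GL_scale_invariant[of n "\<lambda>_. True"] n by simp
  moreover have "fact (Suc n) * l = card (PGL n)"
    using card_arrangements[OF fin inj nv card_l] .
  ultimately have count: "fact (Suc n) * l * (card K - 1) = card (GL n)" by simp
  have "0 < card (GL n)"
    using id_GL finite_GL card_gt_0_iff by blast
  with count have "0 < l" by (metis bot_nat_0.not_eq_extremum mult_0 mult_0_right)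
  moreover have "fact (Suc n) * l * (card K - 1) < card K ^ n\<^sup>2"
    unfolding count using n by (intro card_GL_less) simp
  ultimately show ?thesis
    using PSCA_of_arrangements[OF fin inj card_l] by blast
qed

end

section \<open>Numerical estimates and the bound\<close>

lemma ex_2_power_between:
  assumes "0 < (v :: nat)"
  shows "\<exists>k. v \<le> 2 ^ k \<and> 2 ^ k < 2 * v"
proof -
  define k where "k = (LEAST k. v \<le> 2 ^ k)"
  have "v \<le> 2 ^ v" by (simp add: less_imp_le)
  then have k: "v \<le> 2 ^ k" unfolding k_def by (rule LeastI)
  have "2 ^ k < 2 * v"
  proof (cases k)
    case 0
    then show ?thesis using assms by simp
  next
    case (Suc m)
    then have "\<not> v \<le> 2 ^ m" using not_less_Least[of m "\<lambda>k. v \<le> 2 ^ k"] by (simp add: k_def)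
    then show ?thesis using Suc by simp
  qed
  with k show ?thesis by blast
qed

lemma power_div_pred_mono:
  fixes x y :: real
  assumes "2 \<le> x" "x \<le> y" "2 \<le> N"
  shows "x ^ N / (x - 1) \<le> y ^ N / (y - 1)"
proof -
  \<comment> \<open>This product equals \<open>y\<^sup>2 * (x - 1) - x\<^sup>2 * (y - 1)\<close>,
    which settles exponent 2; the remaining factors \<open>x ^ m \<le> y ^ m\<close> are multiplied
    in afterwards.\<close>
  have "0 \<le> (y - x) * ((x - 1) * (y - 1) - 1)"
    using assms mult_mono[of 1 "x - 1" 1 "y - 1"] by (intro mult_nonneg_nonneg) auto
  then have sq: "x\<^sup>2 * (y - 1) \<le> y\<^sup>2 * (x - 1)"
    by (simp add: algebra_simps power2_eq_square)
  obtain m where N: "N = m + 2" using assms(3) by (metis add.commute le_Suc_ex)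
  have "x ^ m * (x\<^sup>2 * (y - 1)) \<le> y ^ m * (y\<^sup>2 * (x - 1))"
    using assms by (intro mult_mono[OF power_mono sq]) auto
  then have "x ^ N * (y - 1) \<le> y ^ N * (x - 1)"
    unfolding N power_add mult.assoc .
  then show ?thesis using assms by (simp add: divide_simps)
qed

theorem theorem1p1:
  fixes v t :: nat
  assumes "4 \<le> t" and "t \<le> v"
  shows "real (PSCA_g v t) < (2 * real v) ^ ((t - 1)\<^sup>2) / (fact t * (2 * real v - 1))"
proof -
  obtain k where k: "v \<le> 2 ^ k" "2 ^ k < 2 * v"
    using ex_2_power_between[of v] assms by auto
  \<comment> \<open>For \<open>k = 0\<close> the first bound would give
    \<open>v \<le> 1\<close>.\<close>
  then have "0 < k" using assms by (cases k) auto
  from finite_field_2_power[OF this] obtain K :: "bit alg_closure set"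
    where K: "finite_subfield K" "card K = 2 ^ k" by blast
  interpret finite_subfield K by (rule K(1))
  define q where "q = card K"
  have q: "v \<le> q" "q < 2 * v" using k K(2) by (auto simp: q_def)
  let ?n = "t - 1"
  have t: "Suc ?n = t" and n: "2 \<le> ?n" using assms by auto
  obtain l Y where l: "0 < l" "is_PSCA v t l Y" "fact t * l * (q - 1) < q ^ ?n\<^sup>2"
    using ex_PSCA_PGL[of ?n v] assms q n unfolding t q_def by blast
  have "PSCA_g v t \<le> l"
    unfolding PSCA_g_def using l(1,2) by (intro Least_le) blast
  have "real (fact t * l * (q - 1)) < real (q ^ ?n\<^sup>2)"
    using l(3) by (simp only: of_nat_less_iff)
  \<comment> \<open>Since \<open>q\<close> is at least 4, the natural-number subtraction
    \<open>q - 1\<close> is not truncated.\<close>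
  then have "real l * fact t * (real q - 1) < real q ^ ?n\<^sup>2"
    using q assms by (simp add: of_nat_diff mult_ac)
  then have "real l * fact t < real q ^ ?n\<^sup>2 / (real q - 1)"
    using q assms by (simp add: pos_less_divide_eq)
  \<comment> \<open>Strictness already comes from the count of \<open>GL\<close>, so a weak
    inequality suffices for passing from \<open>q\<close> to \<open>2 * v\<close>.\<close>
  also have "\<dots> \<le> (2 * real v) ^ ?n\<^sup>2 / (2 * real v - 1)"
  proof (rule power_div_pred_mono)
    have "2\<^sup>2 \<le> ?n\<^sup>2" using assms by (intro power_mono) auto
    then show "2 \<le> ?n\<^sup>2" by simp
  qed (use q assms in auto)
  finally have "real l < (2 * real v) ^ ?n\<^sup>2 / (2 * real v - 1) / fact t"
    by (rule mult_imp_less_div_pos[OF fact_gt_zero])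
  also have "\<dots> = (2 * real v) ^ ?n\<^sup>2 / (fact t * (2 * real v - 1))"
    by (simp add: mult.commute)
  finally show ?thesis using \<open>PSCA_g v t \<le> l\<close> by linarith
qed

end
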